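(* Let $S\subset\mathbb{R}^n$ be a nonempty compact set and $J:\mathbb{R}^n\to\mathbb{R}$. If $J$ is Lipschitz differentiable, then for any sufficiently large $\beta$, the sequence $(x^k,y^k,w^k)$ generated by the ADMM algorithm given in the context (for minimizing $J$ over $S$) has at least one limit point, and each limit point is a stationary point of the augmented Lagrangian $\mathcal{L}_\beta$.
   Context: The problem $\min_{x\in S}J(x)$ is rewritten as minimizing $\iota_S(x)+J(y)$ over $x,y\in\mathbb{R}^n$ subject to $x-y=0$, where $\iota_S(x)=0$ if $x\in S$ and $\infty$ otherwise. Augmented Lagrangian: $\mathcal{L}_\beta(x,y,w)=\iota_S(x)+J(y)+\langle w,x-y\rangle+\frac{\beta}{2}\|x-y\|^2$. ADMM: from arbitrary $x^0,y^0,w^0$, for $k=0,1,\dots$: $x^{k+1}\in\mathrm{Proj}_S(y^k-\frac{w^k}{\beta})$ (a nearest point in $S$); $y^{k+1}\in\operatorname{argmin}_yJ(y)+\frac{\beta}{2}\|y-\frac{w^k}{\beta}-x^{k+1}\|^2$; $w^{k+1}=w^k+\beta(x^{k+1}-y^{k+1})$. Lipschitz differentiable: differentiable with Lipschitz continuous gradient. A stationary point is a point where $0\in\partial\mathcal{L}_\beta$, with $\partial$ the general (limiting) subdifferential (Rockafellar–Wets, Def. 8.3). *)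

theory Defs
  imports "HOL-Analysis.Analysis"
begin

definition lipschitz_differentiable :: "('a::real_inner \<Rightarrow> real) \<Rightarrow> bool" where
  "lipschitz_differentiable J \<longleftrightarrow>
     (\<exists>G L. (\<forall>x. GDERIV J x :> G x) \<and> L-lipschitz_on UNIV G)"

definition set_indicator :: "'a set \<Rightarrow> 'a \<Rightarrow> ereal" where
  "set_indicator S x = (if x \<in> S then 0 else \<infinity>)"

definition aug_lagrangian ::
  "'a::real_inner set \<Rightarrow> ('a \<Rightarrow> real) \<Rightarrow> real \<Rightarrow> 'a \<times> 'a \<times> 'a \<Rightarrow> ereal" where
  "aug_lagrangian S J \<beta> = (\<lambda>(x, y, w).
     set_indicator S x + ereal (J y + w \<bullet> (x - y) + \<beta> / 2 * (norm (x - y))\<^sup>2))"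

text \<open>The library's \<open>closest_point\<close> selects one nearest point; here every nearest point is
  admissible, since the set need not be convex.\<close>

definition proj_set :: "'a::metric_space set \<Rightarrow> 'a \<Rightarrow> 'a set" where
  "proj_set S z = {p. is_arg_min (\<lambda>q. dist z q) (\<lambda>q. q \<in> S) p}"

text \<open>The initial triple \<open>(x 0, y 0, w 0)\<close> is arbitrary.\<close>

definition admm_sequence ::
  "'a::real_inner set \<Rightarrow> ('a \<Rightarrow> real) \<Rightarrow> real \<Rightarrow>
     (nat \<Rightarrow> 'a) \<Rightarrow> (nat \<Rightarrow> 'a) \<Rightarrow> (nat \<Rightarrow> 'a) \<Rightarrow> bool" where
  "admm_sequence S J \<beta> x y w \<longleftrightarrow>
     (\<forall>k. x (Suc k) \<in> proj_set S (y k - w k /\<^sub>R \<beta>) \<and>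
          is_arg_min (\<lambda>v. J v + \<beta> / 2 * (norm (v - w k /\<^sub>R \<beta> - x (Suc k)))\<^sup>2) (\<lambda>_. True) (y (Suc k)) \<and>
          w (Suc k) = w k + \<beta> *\<^sub>R (x (Suc k) - y (Suc k)))"

text \<open>Regular and general (limiting) subgradients in the sense of Rockafellar and Wets,
  Variational Analysis, Definition 8.3. The requirement
  \<open>f z \<ge> f x + v \<bullet> (z - x) + o(norm (z - x))\<close> is by convention the one-sided limit condition below.
  There are no subgradients where the function value is infinite, and the convergence
  \<open>u k \<longlonglongrightarrow> x\<close> has to be \<open>f\<close>-attentive.\<close>

definition regular_subdifferential :: "('a::real_inner \<Rightarrow> ereal) \<Rightarrow> 'a \<Rightarrow> 'a set" where
  "regular_subdifferential f x =
     {v. \<bar>f x\<bar> \<noteq> \<infinity> \<and>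
         0 \<le> Liminf (at x) (\<lambda>z. (f z - f x - ereal (v \<bullet> (z - x))) / ereal (norm (z - x)))}"

definition general_subdifferential :: "('a::real_inner \<Rightarrow> ereal) \<Rightarrow> 'a \<Rightarrow> 'a set" where
  "general_subdifferential f x =
     {v. \<bar>f x\<bar> \<noteq> \<infinity> \<and>
         (\<exists>u g. u \<longlonglongrightarrow> x \<and> (\<lambda>k. f (u k)) \<longlonglongrightarrow> f x \<and>
                (\<forall>k. g k \<in> regular_subdifferential f (u k)) \<and> g \<longlonglongrightarrow> v)}"

definition stationary_point :: "('a::real_inner \<Rightarrow> ereal) \<Rightarrow> 'a \<Rightarrow> bool" where
  "stationary_point f x \<longleftrightarrow> 0 \<in> general_subdifferential f x"

definition limit_point_of_seq :: "(nat \<Rightarrow> 'a::topological_space) \<Rightarrow> 'a \<Rightarrow> bool" where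
  "limit_point_of_seq s l \<longleftrightarrow> (\<exists>r. strict_mono r \<and> (s \<circ> r) \<longlonglongrightarrow> l)"

end

theory Submission
  imports Defs
begin

text \<open>
  Let \<open>G\<close> be the gradient of \<open>J\<close>, with Lipschitz constant \<open>L\<close>. The optimality condition of the
  \<open>y\<close>-update, combined with the multiplier update, says \<open>w = G y\<close> after every iteration
  (\<open>multiplier_eq_gradient\<close>). Hence multipliers move by at most \<open>L\<close> times the movement of \<open>y\<close>,
  and the \<open>y\<close>-movement controls everything else.

  The augmented Lagrangian serves as a potential (\<open>lagrangian_value_decreases\<close>). The \<open>x\<close>-update
  does not increase it, even though \<open>S\<close> need not be convex; the \<open>y\<close>-update lowers it by at least
  \<open>\<beta> / 2 - L\<close> times the squared \<open>y\<close>-movement; the multiplier update raises it by the squared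
  \<open>w\<close>-movement divided by \<open>\<beta>\<close>, so by at most \<open>L\<^sup>2 / \<beta>\<close> times the squared \<open>y\<close>-movement. For large
  \<open>\<beta>\<close> the net effect is a decrease. Since \<open>w = G y\<close>, the potential is also bounded below by
  \<open>J x\<close>, hence by the minimum of \<open>J\<close> on the compact set \<open>S\<close> (\<open>lagrangian_value_ge\<close>). It therefore
  converges, the successive differences of \<open>y\<close> and of \<open>w\<close> tend to \<open>0\<close>, and so does
  \<open>x - y\<close>, which is a difference of multipliers divided by \<open>\<beta>\<close>.

  Limit points exist because \<open>x\<close> stays in \<open>S\<close>, \<open>y\<close> is asymptotically equal to \<open>x\<close>, and \<open>w = G y\<close>
  with \<open>G\<close> continuous. Every limit point has the form \<open>(p, p, G p)\<close> with \<open>p\<close> in \<open>S\<close>. Passing to the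
  limit in the minimality property of the \<open>x\<close>-update shows that \<open>p\<close> minimizes
  \<open>G p \<bullet> q + \<beta> / 2 * (norm (q - p))\<^sup>2\<close> over \<open>q\<close> in \<open>S\<close>: the vector \<open>- G p\<close> is a proximal normal
  to \<open>S\<close> at \<open>p\<close>. This makes the augmented Lagrangian fall below its value at the limit point by at
  most a multiple of the squared distance (\<open>stationary_point_aug_lagrangian\<close>), so \<open>0\<close> is already a
  regular subgradient there, and a constant sequence witnesses that it is a general one.
\<close>

section \<open>Functions with Lipschitz continuous gradient\<close>

text \<open>
  On the segment from \<open>u\<close> to \<open>v\<close> the derivative of \<open>J\<close> differs from its value at \<open>u\<close> by at most
  \<open>L * norm (v - u)\<close>, and the mean value inequality applies. Integrating along the segment would
  give \<open>L / 2\<close> instead of \<open>L\<close>, which would only change the threshold for \<open>\<beta>\<close>.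
\<close>

lemma linearization_error_bound:
  fixes J :: "'a::real_inner \<Rightarrow> real"
  assumes deriv: "\<And>u. GDERIV J u :> G u" and lip: "L-lipschitz_on UNIV G"
  shows "\<bar>J v - J u - G u \<bullet> (v - u)\<bar> \<le> L * (norm (v - u))\<^sup>2"
proof -
  have L: "0 \<le> L"
    using lip by (rule lipschitz_on_nonneg)
  have "norm (J v - J u - (v - u) \<bullet> G u) \<le> norm (v - u) * (L * norm (v - u))"
  proof (rule differentiable_bound_linearization[where S = "closed_segment u v"
        and f' = "\<lambda>p h. h \<bullet> G p" and ?x0.0 = u])
    show "u + t *\<^sub>R (v - u) \<in> closed_segment u v" if "t \<in> {0..1}" for t
      using that by (auto simp: in_segment algebra_simps intro!: exI[of _ t])
    show "(J has_derivative (\<lambda>h. h \<bullet> G p)) (at p within closed_segment u v)" for p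
      using deriv[of p] unfolding gderiv_def by (rule has_derivative_at_withinI)
    show "onorm ((\<lambda>h. h \<bullet> G p) - (\<lambda>h. h \<bullet> G u)) \<le> L * norm (v - u)"
      if "p \<in> closed_segment u v" for p
    proof (rule onorm_bound)
      show "0 \<le> L * norm (v - u)"
        using L by simp
      fix h :: 'a
      have "norm (G p - G u) \<le> L * norm (p - u)"
        using lipschitz_onD[OF lip, of p u] by (simp add: dist_norm)
      also have "\<dots> \<le> L * norm (v - u)"
        using segment_bound1[OF that] L by (simp add: mult_left_mono norm_minus_commute)
      finally have "norm h * norm (G p - G u) \<le> norm h * (L * norm (v - u))"
        by (rule mult_left_mono) simp
      moreover have "norm (((\<lambda>h. h \<bullet> G p) - (\<lambda>h. h \<bullet> G u)) h) \<le> norm h * norm (G p - G u)"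
        using Cauchy_Schwarz_ineq2[of h "G p - G u"] by (simp add: inner_diff_right)
      ultimately show "norm (((\<lambda>h. h \<bullet> G p) - (\<lambda>h. h \<bullet> G u)) h) \<le> L * norm (v - u) * norm h"
        by (simp add: mult.commute)
    qed
  qed simp
  then show ?thesis
    by (simp add: inner_commute power2_eq_square mult_ac)
qed

lemma gradient_at_proximal_point:
  fixes J :: "'a::real_inner \<Rightarrow> real"
  assumes deriv: "GDERIV J p :> g"
    and min: "\<And>v. J p + \<beta> / 2 * (norm (p - a))\<^sup>2 \<le> J v + \<beta> / 2 * (norm (v - a))\<^sup>2"
  shows "g + \<beta> *\<^sub>R (p - a) = 0"
proof -
  have "((\<lambda>v. J v + \<beta> / 2 * ((v - a) \<bullet> (v - a))) has_derivative
         (\<lambda>h. h \<bullet> (g + \<beta> *\<^sub>R (p - a)))) (at p)"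
    using deriv unfolding gderiv_def
    by (auto intro!: derivative_eq_intros simp: fun_eq_iff inner_commute inner_add_left
        inner_diff_left algebra_simps)
  then have "(\<lambda>h. h \<bullet> (g + \<beta> *\<^sub>R (p - a))) = (\<lambda>h. 0)"
    by (rule differential_zero_maxmin[OF UNIV_I open_UNIV])
       (use min in \<open>auto simp: power2_norm_eq_inner\<close>)
  then have "(g + \<beta> *\<^sub>R (p - a)) \<bullet> (g + \<beta> *\<^sub>R (p - a)) = 0"
    by meson
  then show ?thesis
    by simp
qed

section \<open>Stationarity from a quadratic minorant\<close>

text \<open>
  The difference quotient that defines regular subgradients is at least \<open>- C * norm (z - p)\<close>, which
  tends to \<open>0\<close>. Thus \<open>0\<close> is a proximal, and therefore a regular, subgradient.
\<close>

lemma zero_regular_subgradientI: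
  fixes f :: "'a::real_inner \<Rightarrow> ereal"
  assumes fin: "\<bar>f p\<bar> \<noteq> \<infinity>" and C: "0 \<le> C"
    and minorant: "\<And>z. f p - ereal (C * (norm (z - p))\<^sup>2) \<le> f z"
  shows "0 \<in> regular_subdifferential f p"
proof -
  obtain c where c: "f p = ereal c"
    using fin by auto
  have quot: "ereal (- (C * norm (z - p))) \<le> (f z - f p - ereal (0 \<bullet> (z - p))) / ereal (norm (z - p))"
    if "z \<noteq> p" for z
  proof (cases "f z")
    case (real r)
    have n: "norm (z - p) > 0"
      using that by simp
    have "c - C * (norm (z - p))\<^sup>2 \<le> r"
      using minorant[of z] c real by simp
    then have "- (C * norm (z - p)) \<le> (r - c) / norm (z - p)"
      using n by (simp add: pos_le_divide_eq power2_eq_square algebra_simps)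
    then show ?thesis
      using real c that by simp
  next
    case PInf
    then show ?thesis
      using c that by simp
  next
    case MInf
    then show ?thesis
      using minorant[of z] c by simp
  qed
  have "((\<lambda>z. - (C * norm (z - p))) \<longlongrightarrow> - (C * norm (p - p))) (at p)"
    by (intro tendsto_intros)
  then have lim: "((\<lambda>z. ereal (- (C * norm (z - p)))) \<longlongrightarrow> 0) (at p)"
    by (simp add: zero_ereal_def)
  show ?thesis
    \<comment> \<open>the punctured neighbourhood filter is trivial in a zero-dimensional space\<close>
  proof (cases "at p = (bot :: 'a filter)")
    case True
    then show ?thesis
      using fin by (simp add: regular_subdifferential_def)
  next
    case False
    have "0 = Liminf (at p) (\<lambda>z. ereal (- (C * norm (z - p))))"
      using lim_imp_Liminf[OF False lim] by simp
    also have "\<dots> \<le> Liminf (at p) (\<lambda>z. (f z - f p - ereal (0 \<bullet> (z - p))) / ereal (norm (z - p)))"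
      by (rule Liminf_mono) (use quot in \<open>auto simp: eventually_at_filter\<close>)
    finally show ?thesis
      using fin by (simp add: regular_subdifferential_def)
  qed
qed

lemma stationary_pointI:
  assumes "0 \<in> regular_subdifferential f p"
  shows "stationary_point f p"
proof -
  have "\<bar>f p\<bar> \<noteq> \<infinity>"
    using assms by (simp add: regular_subdifferential_def)
  then show ?thesis
    unfolding stationary_point_def general_subdifferential_def
    using assms by (intro CollectI conjI exI[of _ "\<lambda>_. p"] exI[of _ "\<lambda>_. 0"]) auto
qed

text \<open>
  For \<open>z = (q, v, u)\<close> with \<open>q\<close> in \<open>S\<close>, linearize \<open>J v\<close> at \<open>p\<close>. The terms of first order are
  \<open>G p \<bullet> (v - p)\<close> from \<open>J\<close> and \<open>G p \<bullet> (q - v)\<close> from the multiplier term; they add up to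
  \<open>G p \<bullet> (q - p)\<close>, which the hypothesis on \<open>S\<close> bounds below by a quadratic. What remains is the
  linearization error of \<open>J\<close> and the product \<open>(u - G p) \<bullet> (q - v)\<close>, both of second order.
\<close>

lemma stationary_point_aug_lagrangian:
  fixes J :: "'a::real_inner \<Rightarrow> real"
  assumes deriv: "\<And>u. GDERIV J u :> G u" and lip: "L-lipschitz_on UNIV G"
    and \<beta>: "0 \<le> \<beta>" and p: "p \<in> S"
    and normal: "\<And>q. q \<in> S \<Longrightarrow> 0 \<le> G p \<bullet> (q - p) + \<beta> / 2 * (norm (q - p))\<^sup>2"
  shows "stationary_point (aug_lagrangian S J \<beta>) (p, p, G p)"
proof (intro stationary_pointI zero_regular_subgradientI)
  have L: "0 \<le> L"
    using lip by (rule lipschitz_on_nonneg)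
  show "\<bar>aug_lagrangian S J \<beta> (p, p, G p)\<bar> \<noteq> \<infinity>"
    using p by (simp add: aug_lagrangian_def set_indicator_def)
  show "0 \<le> \<beta> / 2 + L + 2"
    using \<beta> L by simp
  fix z :: "'a \<times> 'a \<times> 'a"
  obtain q v u where z: "z = (q, v, u)"
    by (cases z) auto
  define N where "N = norm (z - (p, p, G p))"
  have Nq: "norm (q - p) \<le> N" and Nv: "norm (v - p) \<le> N" and Nu: "norm (u - G p) \<le> N"
    unfolding N_def z
    using norm_fst_le[of "q - p" "(v - p, u - G p)"]
      norm_snd_le[of "(v - p, u - G p)" "q - p"]
      norm_fst_le[of "v - p" "u - G p"] norm_snd_le[of "u - G p" "v - p"]
    by auto
  show "aug_lagrangian S J \<beta> (p, p, G p) - ereal ((\<beta> / 2 + L + 2) * (norm (z - (p, p, G p)))\<^sup>2)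
        \<le> aug_lagrangian S J \<beta> z"
  proof (cases "q \<in> S")
    case False
    then show ?thesis
      by (simp add: z aug_lagrangian_def set_indicator_def)
  next
    case True
    have "J p + G p \<bullet> (v - p) - L * (norm (v - p))\<^sup>2 \<le> J v"
      using linearization_error_bound[OF deriv lip, of v p] by linarith
    moreover have "L * (norm (v - p))\<^sup>2 \<le> L * N\<^sup>2" "\<beta> / 2 * (norm (q - p))\<^sup>2 \<le> \<beta> / 2 * N\<^sup>2"
      using Nv Nq L \<beta> by (auto intro!: mult_left_mono power_mono)
    moreover have "- (2 * N\<^sup>2) \<le> (u - G p) \<bullet> (q - v)"
    proof -
      have "norm (q - v) \<le> norm (q - p) + norm (v - p)"
        by (metis norm_triangle_ineq4 diff_diff_eq2 diff_add_cancel)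
      then have "norm (u - G p) * norm (q - v) \<le> N * (2 * N)"
        using Nu Nq Nv order_trans[OF norm_ge_zero Nu] by (intro mult_mono) auto
      then show ?thesis
        using Cauchy_Schwarz_ineq2[of "u - G p" "q - v"] by (simp add: power2_eq_square)
    qed
    moreover have "0 \<le> \<beta> / 2 * (norm (q - v))\<^sup>2"
      using \<beta> by simp
    moreover have "u \<bullet> (q - v) = (u - G p) \<bullet> (q - v) + G p \<bullet> (q - p) - G p \<bullet> (v - p)"
      by (simp add: inner_diff_left inner_diff_right)
    ultimately have "J p - (\<beta> / 2 + L + 2) * N\<^sup>2 \<le> J v + u \<bullet> (q - v) + \<beta> / 2 * (norm (q - v))\<^sup>2"
      using normal[OF True] by (simp add: algebra_simps)
    then show ?thesis
      using True p by (simp add: z aug_lagrangian_def set_indicator_def N_def)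
  qed
qed

section \<open>Convergence of the iterates\<close>

text \<open>
  The initial triple is arbitrary, so the properties of the iterates hold from index \<open>1\<close> on; they
  are stated for \<open>Suc k\<close>. The bound on \<open>\<beta>\<close> leaves enough room to absorb the error terms
  \<open>L\<close> and \<open>L\<^sup>2 / \<beta> \<le> L\<close> with a remainder of at least \<open>1\<close>.
\<close>

locale admm_run =
  fixes S :: "'a::euclidean_space set" and J :: "'a \<Rightarrow> real" and G :: "'a \<Rightarrow> 'a"
    and L \<beta> :: real and x y w :: "nat \<Rightarrow> 'a"
  assumes compact_S: "compact S"
    and deriv: "\<And>u. GDERIV J u :> G u" and lip: "L-lipschitz_on UNIV G"
    and \<beta>_ge: "4 * L + 2 \<le> \<beta>"
    and admm: "admm_sequence S J \<beta> x y w"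
begin

definition lagrangian_value :: "nat \<Rightarrow> real" where
  "lagrangian_value k = J (y k) + w k \<bullet> (x k - y k) + \<beta> / 2 * (norm (x k - y k))\<^sup>2"

lemma L_nonneg: "0 \<le> L"
  using lip by (rule lipschitz_on_nonneg)

lemma \<beta>_pos: "0 < \<beta>"
  using \<beta>_ge L_nonneg by linarith

lemma x_mem: "x (Suc k) \<in> S"
  using admm by (simp add: admm_sequence_def proj_set_def is_arg_min_def)

lemma w_step: "w (Suc k) = w k + \<beta> *\<^sub>R (x (Suc k) - y (Suc k))"
  using admm by (simp add: admm_sequence_def)

text \<open>
  Completing the square turns the projection of \<open>y k - w k /\<^sub>R \<beta>\<close> into minimization over \<open>S\<close> of
  the augmented Lagrangian in its first argument, up to terms that do not depend on it.
\<close>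

lemma x_step_minimal:
  assumes "q \<in> S"
  shows "w k \<bullet> x (Suc k) + \<beta> / 2 * (norm (x (Suc k) - y k))\<^sup>2
         \<le> w k \<bullet> q + \<beta> / 2 * (norm (q - y k))\<^sup>2"
proof -
  have expand: "\<beta> / 2 * (dist (y k - w k /\<^sub>R \<beta>) r)\<^sup>2 =
      w k \<bullet> r + \<beta> / 2 * (norm (r - y k))\<^sup>2 - w k \<bullet> y k + (norm (w k))\<^sup>2 / (2 * \<beta>)" for r
  proof -
    have "(dist (y k - w k /\<^sub>R \<beta>) r)\<^sup>2 = (norm ((r - y k) + w k /\<^sub>R \<beta>))\<^sup>2"
      by (simp add: dist_norm norm_minus_commute algebra_simps)
    also have "\<dots> = (norm (r - y k))\<^sup>2 + 2 * (w k \<bullet> (r - y k)) / \<beta> + (norm (w k))\<^sup>2 / \<beta>\<^sup>2"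
      unfolding power2_norm_eq_inner
      by (simp add: inner_add_left inner_add_right inner_commute power2_eq_square divide_simps)
        (simp add: algebra_simps)
    finally show ?thesis
      using \<beta>_pos by (simp add: inner_diff_right power2_eq_square field_simps)
  qed
  have "dist (y k - w k /\<^sub>R \<beta>) (x (Suc k)) \<le> dist (y k - w k /\<^sub>R \<beta>) q"
    using admm assms by (auto simp: admm_sequence_def proj_set_def is_arg_min_def not_less)
  then have "\<beta> / 2 * (dist (y k - w k /\<^sub>R \<beta>) (x (Suc k)))\<^sup>2 \<le> \<beta> / 2 * (dist (y k - w k /\<^sub>R \<beta>) q)\<^sup>2"
    using \<beta>_pos by (intro mult_left_mono power_mono) auto
  then show ?thesis
    unfolding expand by linarith
qed

text \<open>
  The gradient of the objective of the \<open>y\<close>-update vanishes at \<open>y (Suc k)\<close>; the multiplier update is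
  made so that this equation reads \<open>w (Suc k) = G (y (Suc k))\<close>.
\<close>

lemma multiplier_eq_gradient: "w (Suc k) = G (y (Suc k))"
proof -
  have "G (y (Suc k)) + \<beta> *\<^sub>R (y (Suc k) - (w k /\<^sub>R \<beta> + x (Suc k))) = 0"
    by (rule gradient_at_proximal_point[OF deriv])
       (use admm in \<open>auto simp: admm_sequence_def is_arg_min_def not_less diff_diff_eq\<close>)
  then show ?thesis
    using \<beta>_pos by (simp add: w_step algebra_simps)
qed

text \<open>
  Primed letters are the new iterates. The effect of the \<open>y\<close>-update and of the multiplier update is
  computed around the new multiplier \<open>u'\<close>, which is the gradient at \<open>v'\<close>: then the terms of first
  order cancel against the linearization of \<open>J\<close>, and only squares of differences remain.
\<close>

lemma lagrangian_value_decreases: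
  "lagrangian_value (Suc (Suc k)) + (norm (y (Suc (Suc k)) - y (Suc k)))\<^sup>2
   \<le> lagrangian_value (Suc k)"
proof -
  define p v u where "p = x (Suc k)" and "v = y (Suc k)" and "u = w (Suc k)"
  define p' v' u' where "p' = x (Suc (Suc k))" and "v' = y (Suc (Suc k))" and "u' = w (Suc (Suc k))"
  note defs = p_def v_def u_def p'_def v'_def u'_def
  define d where "d = (norm (v' - v))\<^sup>2"
  have d: "0 \<le> d"
    by (simp add: d_def)
  have x_part: "u \<bullet> p' + \<beta> / 2 * (norm (p' - v))\<^sup>2 \<le> u \<bullet> p + \<beta> / 2 * (norm (p - v))\<^sup>2"
    unfolding defs by (rule x_step_minimal[OF x_mem])
  have u': "u' = u + \<beta> *\<^sub>R (p' - v')"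
    unfolding defs by (rule w_step)
  have y_part: "u' \<bullet> (v - v') - L * d \<le> J v - J v'"
    using linearization_error_bound[OF deriv lip, of v v']
    by (simp add: defs d_def multiplier_eq_gradient norm_minus_commute abs_le_iff)
  have square: "\<beta> / 2 * (norm (p' - v))\<^sup>2 =
      \<beta> / 2 * (norm (p' - v'))\<^sup>2 + \<beta> * ((p' - v') \<bullet> (v' - v)) + \<beta> / 2 * d"
    unfolding d_def power2_norm_eq_inner
    by (simp add: inner_diff_left inner_diff_right inner_commute algebra_simps)
  \<comment> \<open>The increase by the multiplier update is \<open>(u' - u) \<bullet> (p' - v')\<close>, that is
    \<open>\<beta> * (norm (p' - v'))\<^sup>2\<close>.\<close>
  have "\<beta> * (\<beta> * (norm (p' - v'))\<^sup>2) = (norm (u' - u))\<^sup>2"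
    using \<beta>_pos by (simp add: u' power_mult_distrib power2_eq_square)
  also have "\<dots> \<le> (L * norm (v' - v))\<^sup>2"
    using lipschitz_onD[OF lip, of v' v]
    by (intro power_mono) (auto simp: defs multiplier_eq_gradient dist_norm)
  also have "\<dots> \<le> \<beta> * (L * d)"
    using mult_right_mono[of L \<beta> "L * d"] \<beta>_ge L_nonneg d
    by (simp add: d_def power_mult_distrib power2_eq_square mult_ac)
  finally have w_part: "\<beta> * (norm (p' - v'))\<^sup>2 \<le> L * d"
    using \<beta>_pos by simp
  have "d \<le> (\<beta> / 2 - 2 * L) * d"
    using \<beta>_ge d mult_right_mono[of 1 "\<beta> / 2 - 2 * L" d] by simp
  then have budget: "d \<le> \<beta> / 2 * d - 2 * (L * d)"
    by (simp add: algebra_simps)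
  have "u' \<bullet> (p' - v') = u \<bullet> (p' - v') + \<beta> * (norm (p' - v'))\<^sup>2"
    by (simp add: u' inner_add_left power2_norm_eq_inner)
  moreover have "u' \<bullet> (v - v') = u \<bullet> v - u \<bullet> v' - \<beta> * ((p' - v') \<bullet> (v' - v))"
    by (simp add: u' inner_add_left inner_diff_right algebra_simps)
  moreover have "u \<bullet> (p' - v') = u \<bullet> p' - u \<bullet> v'" "u \<bullet> (p - v) = u \<bullet> p - u \<bullet> v"
    by (simp_all add: inner_diff_right)
  ultimately have "J v' + u' \<bullet> (p' - v') + \<beta> / 2 * (norm (p' - v'))\<^sup>2 + d
      \<le> J v + u \<bullet> (p - v) + \<beta> / 2 * (norm (p - v))\<^sup>2"
    using x_part y_part w_part budget square by linarith
  then show ?thesis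
    by (simp add: lagrangian_value_def d_def defs)
qed

text \<open>
  As \<open>w (Suc k)\<close> is the gradient of \<open>J\<close> at \<open>y (Suc k)\<close>, the first two terms of the Lagrangian are
  the linearization of \<open>J (x (Suc k))\<close>, whose error the penalty term dominates.
\<close>

lemma lagrangian_value_ge:
  "J (x (Suc k)) + (norm (x (Suc k) - y (Suc k)))\<^sup>2 \<le> lagrangian_value (Suc k)"
proof -
  define d where "d = (norm (x (Suc k) - y (Suc k)))\<^sup>2"
  have "J (x (Suc k)) - L * d \<le> J (y (Suc k)) + w (Suc k) \<bullet> (x (Suc k) - y (Suc k))"
    using linearization_error_bound[OF deriv lip, of "x (Suc k)" "y (Suc k)"]
    by (simp add: d_def multiplier_eq_gradient abs_le_iff)
  moreover have "d \<le> (\<beta> / 2 - L) * d"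
    using \<beta>_ge L_nonneg mult_right_mono[of 1 "\<beta> / 2 - L" d] by (simp add: d_def)
  ultimately show ?thesis
    by (simp add: lagrangian_value_def algebra_simps flip: d_def)
qed

lemma J_bounded_below: "\<exists>m. \<forall>q\<in>S. m \<le> J q"
proof -
  have "continuous_on S J"
    using deriv unfolding gderiv_def
    by (meson continuous_at_imp_continuous_on has_derivative_continuous)
  then have "bounded (J ` S)"
    using compact_S by (intro compact_imp_bounded compact_continuous_image)
  then show ?thesis
    by (auto dest!: bounded_imp_bdd_below simp: bdd_below_def)
qed

lemma decseq_lagrangian_value: "decseq (\<lambda>k. lagrangian_value (Suc k))"
proof (rule decseq_SucI)
  fix k
  show "lagrangian_value (Suc (Suc k)) \<le> lagrangian_value (Suc k)"
    using lagrangian_value_decreases[of k]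
      zero_le_power2[of "norm (y (Suc (Suc k)) - y (Suc k))"] by linarith
qed

lemma y_step_tendsto_0: "(\<lambda>k. y (Suc (Suc k)) - y (Suc k)) \<longlonglongrightarrow> 0"
proof -
  obtain m where m: "\<forall>q\<in>S. m \<le> J q"
    using J_bounded_below by blast
  have "m \<le> lagrangian_value (Suc k)" for k
    using bspec[OF m x_mem[of k]] lagrangian_value_ge[of k]
      zero_le_power2[of "norm (x (Suc k) - y (Suc k))"] by linarith
  then obtain c where c: "(\<lambda>k. lagrangian_value (Suc k)) \<longlonglongrightarrow> c"
    using decseq_convergent[OF decseq_lagrangian_value] by blast
  have "(\<lambda>k. lagrangian_value (Suc k) - lagrangian_value (Suc (Suc k))) \<longlonglongrightarrow> c - c"
    by (intro tendsto_diff c LIMSEQ_Suc[OF c])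
  then have "(\<lambda>k. lagrangian_value (Suc k) - lagrangian_value (Suc (Suc k))) \<longlonglongrightarrow> 0"
    by simp
  then have "(\<lambda>k. (norm (y (Suc (Suc k)) - y (Suc k)))\<^sup>2) \<longlonglongrightarrow> 0"
  proof (rule tendsto_sandwich[OF _ _ tendsto_const, rotated 2])
    show "\<forall>\<^sub>F k in sequentially. (norm (y (Suc (Suc k)) - y (Suc k)))\<^sup>2
        \<le> lagrangian_value (Suc k) - lagrangian_value (Suc (Suc k))"
      using lagrangian_value_decreases by (simp add: le_diff_eq add.commute)
  qed simp
  then show ?thesis
    using tendsto_real_sqrt by (fastforce intro: tendsto_norm_zero_cancel)
qed

lemma w_step_tendsto_0: "(\<lambda>k. w (Suc (Suc k)) - w (Suc k)) \<longlonglongrightarrow> 0"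
proof (rule Lim_null_comparison)
  show "\<forall>\<^sub>F k in sequentially. norm (w (Suc (Suc k)) - w (Suc k))
      \<le> L * norm (y (Suc (Suc k)) - y (Suc k))"
    using lipschitz_onD[OF lip] by (simp add: multiplier_eq_gradient dist_norm)
  show "(\<lambda>k. L * norm (y (Suc (Suc k)) - y (Suc k))) \<longlonglongrightarrow> 0"
    using tendsto_mult_right_zero[OF tendsto_norm_zero[OF y_step_tendsto_0]] .
qed

lemma constraint_residual_tendsto_0: "(\<lambda>k. x k - y k) \<longlonglongrightarrow> 0"
proof -
  have "x (Suc (Suc k)) - y (Suc (Suc k)) = (w (Suc (Suc k)) - w (Suc k)) /\<^sub>R \<beta>" for k
    using w_step[of "Suc k"] \<beta>_pos by simp
  then have "(\<lambda>k. x (Suc (Suc k)) - y (Suc (Suc k))) \<longlonglongrightarrow> 0"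
    using tendsto_scaleR[OF tendsto_const w_step_tendsto_0, of "inverse \<beta>"] by simp
  then show ?thesis
    by (rule LIMSEQ_imp_Suc[OF LIMSEQ_imp_Suc])
qed

lemma limit_point_exists: "\<exists>l. limit_point_of_seq (\<lambda>k. (x k, y k, w k)) l"
proof -
  obtain p r where r: "strict_mono r" and p: "((\<lambda>k. x (Suc k)) \<circ> r) \<longlonglongrightarrow> p"
    using compact_S x_mem unfolding compact_def by metis
  define s where "s = Suc \<circ> r"
  have s: "strict_mono s"
    using r by (auto simp: s_def strict_mono_def)
  have xs: "(x \<circ> s) \<longlonglongrightarrow> p"
    using p by (simp add: s_def comp_def)
  have "(\<lambda>k. x (s k) - (x (s k) - y (s k))) \<longlonglongrightarrow> p - 0"
    using xs LIMSEQ_subseq_LIMSEQ[OF constraint_residual_tendsto_0 s]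
    by (intro tendsto_diff) (auto simp: comp_def)
  then have ys: "(\<lambda>k. y (s k)) \<longlonglongrightarrow> p"
    by simp
  have "isCont G p"
    using lipschitz_on_continuous_on[OF lip] by (simp add: continuous_on_eq_continuous_at)
  then have "(\<lambda>k. G (y (s k))) \<longlonglongrightarrow> G p"
    using ys by (rule isCont_tendsto_compose)
  then have "(\<lambda>k. w (s k)) \<longlonglongrightarrow> G p"
    by (simp add: s_def multiplier_eq_gradient)
  then have "((\<lambda>k. (x k, y k, w k)) \<circ> s) \<longlonglongrightarrow> (p, p, G p)"
    using xs ys by (auto simp: comp_def intro!: tendsto_intros)
  then show ?thesis
    using s unfolding limit_point_of_seq_def by blast
qed

text \<open>
  The \<open>x\<close>-update that produces an iterate uses the \<open>y\<close> and \<open>w\<close> of the previous step. Because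
  successive differences vanish, these have the same limits along the subsequence, so the
  minimality property passes to the limit point.
\<close>

lemma limit_point_stationary:
  assumes "limit_point_of_seq (\<lambda>k. (x k, y k, w k)) l"
  shows "stationary_point (aug_lagrangian S J \<beta>) l"
proof -
  obtain r0 where r0: "strict_mono r0" and l0: "((\<lambda>k. (x k, y k, w k)) \<circ> r0) \<longlonglongrightarrow> l"
    using assms unfolding limit_point_of_seq_def by blast
  \<comment> \<open>Shift by two, so that the iterates and their predecessors have index at least \<open>1\<close>.\<close>
  define r where "r k = r0 (k + 2) - 2" for k
  have ge: "k + 2 \<le> r0 (k + 2)" for k
    using strict_mono_imp_increasing[OF r0] by blast
  have r_eq: "r0 (k + 2) = Suc (Suc (r k))" for k
    using ge[of k] by (simp add: r_def)
  have r: "strict_mono r"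
  proof (rule strict_monoI)
    fix i j :: nat
    assume "i < j"
    then have "r0 (i + 2) < r0 (j + 2)"
      using r0 by (simp add: strict_mono_def)
    then show "r i < r j"
      unfolding r_eq by simp
  qed
  obtain p v u where l: "l = (p, v, u)"
    by (cases l) auto
  have lim: "(\<lambda>k. (x (Suc (Suc (r k))), y (Suc (Suc (r k))), w (Suc (Suc (r k))))) \<longlonglongrightarrow> (p, v, u)"
    using LIMSEQ_ignore_initial_segment[OF l0, of 2] by (simp add: l comp_def r_eq del: add_2_eq_Suc')
  have lx: "(\<lambda>k. x (Suc (Suc (r k)))) \<longlonglongrightarrow> p"
    and ly: "(\<lambda>k. y (Suc (Suc (r k)))) \<longlonglongrightarrow> v"
    and lw: "(\<lambda>k. w (Suc (Suc (r k)))) \<longlonglongrightarrow> u"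
    using tendsto_fst[OF lim] tendsto_fst[OF tendsto_snd[OF lim]] tendsto_snd[OF tendsto_snd[OF lim]]
    by simp_all
  have "(\<lambda>k. x (Suc (Suc (r k))) - y (Suc (Suc (r k)))) \<longlonglongrightarrow> 0"
    using LIMSEQ_subseq_LIMSEQ[OF LIMSEQ_Suc[OF LIMSEQ_Suc[OF constraint_residual_tendsto_0]] r]
    by (simp add: comp_def)
  then have pv: "p = v"
    using LIMSEQ_unique[OF tendsto_diff[OF lx ly], of 0] by simp
  have "isCont G v"
    using lipschitz_on_continuous_on[OF lip] by (simp add: continuous_on_eq_continuous_at)
  then have "(\<lambda>k. G (y (Suc (Suc (r k))))) \<longlonglongrightarrow> G v"
    using ly by (rule isCont_tendsto_compose)
  then have u: "u = G p"
    using LIMSEQ_unique[OF lw] by (simp add: multiplier_eq_gradient pv)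
  have "p \<in> S"
    using closed_sequentially[OF compact_imp_closed[OF compact_S] _ lx] x_mem by blast
  have "(\<lambda>k. y (Suc (Suc (r k))) - (y (Suc (Suc (r k))) - y (Suc (r k)))) \<longlonglongrightarrow> v - 0"
    using LIMSEQ_subseq_LIMSEQ[OF y_step_tendsto_0 r] by (intro tendsto_diff ly) (simp add: comp_def)
  then have ly': "(\<lambda>k. y (Suc (r k))) \<longlonglongrightarrow> p"
    by (simp add: pv)
  have "(\<lambda>k. w (Suc (Suc (r k))) - (w (Suc (Suc (r k))) - w (Suc (r k)))) \<longlonglongrightarrow> u - 0"
    using LIMSEQ_subseq_LIMSEQ[OF w_step_tendsto_0 r] by (intro tendsto_diff lw) (simp add: comp_def)
  then have lw': "(\<lambda>k. w (Suc (r k))) \<longlonglongrightarrow> G p"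
    by (simp add: u)
  have "0 \<le> G p \<bullet> (q - p) + \<beta> / 2 * (norm (q - p))\<^sup>2" if "q \<in> S" for q
  proof -
    have "(\<lambda>k. w (Suc (r k)) \<bullet> x (Suc (Suc (r k))) + \<beta> / 2 * (norm (x (Suc (Suc (r k))) - y (Suc (r k))))\<^sup>2)
        \<longlonglongrightarrow> G p \<bullet> p + \<beta> / 2 * (norm (p - p))\<^sup>2"
      by (intro tendsto_intros lx ly' lw')
    moreover have "(\<lambda>k. w (Suc (r k)) \<bullet> q + \<beta> / 2 * (norm (q - y (Suc (r k))))\<^sup>2)
        \<longlonglongrightarrow> G p \<bullet> q + \<beta> / 2 * (norm (q - p))\<^sup>2"
      by (intro tendsto_intros ly' lw')
    ultimately have "G p \<bullet> p + \<beta> / 2 * (norm (p - p))\<^sup>2 \<le> G p \<bullet> q + \<beta> / 2 * (norm (q - p))\<^sup>2"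
      by (rule LIMSEQ_le) (use x_step_minimal[OF that] in blast)
    then show ?thesis
      by (simp add: inner_diff_right)
  qed
  then show ?thesis
    using stationary_point_aug_lagrangian[OF deriv lip _ \<open>p \<in> S\<close>, of \<beta>] \<beta>_pos
    by (simp add: l u flip: pv)
qed

end

theorem corollary2:
  fixes S :: "(real ^ 'n) set" and J :: "real ^ 'n \<Rightarrow> real"
  assumes "compact S" and "S \<noteq> {}"
    and "lipschitz_differentiable J"
  shows "\<exists>\<beta>\<^sub>0>0. \<forall>\<beta>\<ge>\<beta>\<^sub>0. \<forall>x y w. admm_sequence S J \<beta> x y w \<longrightarrow>
           (\<exists>l. limit_point_of_seq (\<lambda>k. (x k, y k, w k)) l) \<and>
           (\<forall>l. limit_point_of_seq (\<lambda>k. (x k, y k, w k)) l \<longrightarrow>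
                stationary_point (aug_lagrangian S J \<beta>) l)"
proof -
  obtain G L where deriv: "\<And>u. GDERIV J u :> G u" and lip: "L-lipschitz_on UNIV G"
    using assms(3) unfolding lipschitz_differentiable_def by blast
  have run: "admm_run S J G L \<beta> x y w"
    if "4 * L + 2 \<le> \<beta>" "admm_sequence S J \<beta> x y w" for \<beta> x y w
    using assms(1) deriv lip that by unfold_locales
  show ?thesis
  proof (intro exI[of _ "4 * L + 2"] conjI allI impI)
    show "0 < 4 * L + 2"
      using lipschitz_on_nonneg[OF lip] by simp
  qed (use admm_run.limit_point_exists[OF run] admm_run.limit_point_stationary[OF run] in blast)+
qed

end
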